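(* For the Tseitin contradiction $T_n$ on the $n\times n$ toroidal rectangular grid ($n$ odd), $$S_{3\text{-SRC-II}}(T_n)=\mathcal{O}(n^2).$$
   Context: Let $G=\langle V,E\rangle$ be a graph and $\alpha:V\to\mathbb{F}_2$ with $\sum_{v}\alpha(v)=1$. The Tseitin formula on $G$ with charge $\alpha$ has variables $x_e$, $e\in E$, and encodes for every $v\in V$ the equation $\sum_{e\ni v}x_e=\alpha(v)\pmod 2$ by the $2^{\deg(v)-1}$ clauses of width $\deg(v)$ excluding the assignments to $\{x_e: e\ni v\}$ that violate the equation. It is a Tseitin contradiction if $|V|$ is odd and $\alpha(v)=1$ for all $v$. $T_n$ ($n$ odd, $n\ge 3$) is the Tseitin contradiction on the toroidal rectangular grid of size $n\times n$: vertices $(i,j)\in(\mathbb{Z}/n)^2$, edges joining $(i,j)$ to $(i+1,j)$ and to $(i,j+1)$. A clause is a disjunction (set) of literals. For $k\ge1$, a $k$-symmetry is a bijection $\phi$ of literals onto literals with $\phi(\lnot x)=\lnot\phi(x)$ and $\phi(x)=x$ for all variables $x$ except at most $k$ of them; it acts on clauses literal by literal. A $k$-SRC-II proof (Resolution with local $k$-symmetries) of an unsatisfiable CNF is a sequence of clauses ending with the empty clause, each of which is an input clause, or is obtained from earlier clauses by the resolution rule (from $A\lor x$ and $B\lor\lnot x$ infer $A\lor B$), or is obtained by the symmetry rule: if a clause $A$ was inferred earlier in the proof from $B_1,\dots,B_l$, and $\phi$ is a $k$-symmetry such that all $B_i$ and all $\phi(B_i)$ are input clauses, infer $\phi(A)$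 in one step. There is no weakening rule. $S_\Pi(\Phi)$ is the number of steps in the shortest proof of $\Phi$ in $\Pi$. *)

theory Defs
  imports Complex_Main "HOL-Library.Z2" "HOL-Library.Extended_Nat" "HOL-Library.Landau_Symbols"
begin

datatype 'x lit = Pos (var: 'x) | Neg (var: 'x)

fun neg :: "'x lit \<Rightarrow> 'x lit" where
  "neg (Pos x) = Neg x"
| "neg (Neg x) = Pos x"

type_synonym 'x clause = "'x lit set"
type_synonym 'x cnf = "'x clause set"

definition vars :: "'x cnf \<Rightarrow> 'x set" where
  "vars F = (\<Union>C\<in>F. var ` C)"

definition lits :: "'x set \<Rightarrow> 'x lit set" where
  "lits X = Pos ` X \<union> Neg ` X"

definition k_symmetry :: "nat \<Rightarrow> 'x set \<Rightarrow> ('x lit \<Rightarrow> 'x lit) \<Rightarrow> bool" where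
  "k_symmetry k X \<phi> \<longleftrightarrow>
     bij_betw \<phi> (lits X) (lits X) \<and>
     (\<forall>l\<in>lits X. \<phi> (neg l) = neg (\<phi> l)) \<and>
     finite {x\<in>X. \<phi> (Pos x) \<noteq> Pos x} \<and>
     card {x\<in>X. \<phi> (Pos x) \<noteq> Pos x} \<le> k"

definition resolvent :: "'x \<Rightarrow> 'x clause \<Rightarrow> 'x clause \<Rightarrow> 'x clause \<Rightarrow> bool" where
  "resolvent x C D R \<longleftrightarrow>
     Pos x \<in> C \<and> Neg x \<in> D \<and> R = (C - {Pos x}) \<union> (D - {Neg x})"

text \<open>
  The proposition \<open>src2_inferred k F \<pi> i \<B>\<close> says that the \<open>i\<close>-th clause of the sequence
  \<open>\<pi>\<close> is inferred, within \<open>\<pi>\<close>, from exactly the set \<open>\<B>\<close> of clauses of \<open>F\<close>. A clause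
  obtained by the symmetry rule from \<open>A\<close>, where \<open>A\<close> was inferred from \<open>\<B>\<close>, counts as
  inferred from the images of the clauses in \<open>\<B>\<close>; keeping \<open>\<B>\<close> itself would make repeated
  applications of the rule unsound.
\<close>

inductive src2_inferred ::
    "nat \<Rightarrow> 'x cnf \<Rightarrow> 'x clause list \<Rightarrow> nat \<Rightarrow> 'x cnf \<Rightarrow> bool"
  for k :: nat and F :: "'x cnf" and \<pi> :: "'x clause list" where
  input: "\<lbrakk>i < length \<pi>; \<pi> ! i \<in> F\<rbrakk> \<Longrightarrow> src2_inferred k F \<pi> i {\<pi> ! i}"
| resolution: "\<lbrakk>i < length \<pi>; j < i; l < i;
     src2_inferred k F \<pi> j \<B>; src2_inferred k F \<pi> l \<C>;
     resolvent x (\<pi> ! j) (\<pi> ! l) (\<pi> ! i)\<rbrakk>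
     \<Longrightarrow> src2_inferred k F \<pi> i (\<B> \<union> \<C>)"
| symmetry: "\<lbrakk>i < length \<pi>; j < i; src2_inferred k F \<pi> j \<B>;
     k_symmetry k (vars F) \<phi>; \<B> \<subseteq> F; (`) \<phi> ` \<B> \<subseteq> F; \<pi> ! i = \<phi> ` (\<pi> ! j)\<rbrakk>
     \<Longrightarrow> src2_inferred k F \<pi> i ((`) \<phi> ` \<B>)"

definition src2_proof :: "nat \<Rightarrow> 'x cnf \<Rightarrow> 'x clause list \<Rightarrow> bool" where
  "src2_proof k F \<pi> \<longleftrightarrow>
     \<pi> \<noteq> [] \<and> last \<pi> = {} \<and> (\<forall>i<length \<pi>. \<exists>\<B>. src2_inferred k F \<pi> i \<B>)"

text \<open>The minimal proof length is \<open>\<infinity>\<close> if there is no proof.\<close>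

definition src2_size :: "nat \<Rightarrow> 'x cnf \<Rightarrow> enat" where
  "src2_size k F = (INF \<pi>\<in>{\<pi>. src2_proof k F \<pi>}. enat (length \<pi>))"

text \<open>A graph is given by its vertex set \<open>V\<close> and its set \<open>E\<close> of two-element edges.\<close>

definition incident :: "'v set set \<Rightarrow> 'v \<Rightarrow> 'v set set" where
  "incident E v = {e\<in>E. v \<in> e}"

definition excluding_clause :: "'x set \<Rightarrow> ('x \<Rightarrow> bit) \<Rightarrow> 'x clause" where
  "excluding_clause X a = (\<lambda>x. if a x = 1 then Neg x else Pos x) ` X"

definition tseitin :: "'v set \<Rightarrow> 'v set set \<Rightarrow> ('v \<Rightarrow> bit) \<Rightarrow> 'v set cnf" where
  "tseitin V E \<alpha> =
     {excluding_clause (incident E v) a | v a. v \<in> V \<and> (\<Sum>e\<in>incident E v. a e) \<noteq> \<alpha> v}"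

definition torus_vertices :: "nat \<Rightarrow> (nat \<times> nat) set" where
  "torus_vertices n = {..<n} \<times> {..<n}"

definition torus_edges :: "nat \<Rightarrow> (nat \<times> nat) set set" where
  "torus_edges n =
     (\<lambda>(i, j). {(i, j), (Suc i mod n, j)}) ` torus_vertices n \<union>
     (\<lambda>(i, j). {(i, j), (i, Suc j mod n)}) ` torus_vertices n"

definition torus_tseitin :: "nat \<Rightarrow> (nat \<times> nat) set cnf" where
  "torus_tseitin n = tseitin (torus_vertices n) (torus_edges n) (\<lambda>_. 1)"

end

theory Submission imports Defs begin

text \<open>
  Add up the equations of the vertices row by row. If \<open>U\<close> is the set of vertices treated so far,
  the sum is a parity constraint on the edges leaving \<open>U\<close>, which in plain resolution would need
  exponentially many clauses. Let \<open>a\<close>, \<open>b\<close> be adjacent vertices of \<open>U\<close> with neighbours \<open>p\<close>, \<open>q\<close>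
  outside of \<open>U\<close>. Negating the variables of the path \<open>p\<close>, \<open>a\<close>, \<open>b\<close>, \<open>q\<close> is a 3-symmetry that
  preserves all equations of \<open>U\<close>. Hence a clause in which the sign of \<open>ap\<close> has been varied yields one
  in which the sign of \<open>bq\<close> has been varied. So it suffices to maintain the clauses
  of the constraint in which all signs are fixed except those of the edges in a carried set of bounded
  size: those at the vertex to be added next, at the first vertex of the current row, and at
  \<open>(0, 0)\<close>. When moving on within a row, the edge from the following vertex to the previous row (and, in
  the last row, the one to row 0) enters the carried set by a symmetry. The edges at the first vertex
  of the current row supply the sign variation needed to close this row and to begin the next one,
  the edges at \<open>(0, 0)\<close> that needed in the last row. Each vertex costs a constant number of steps.
\<close>

section \<open>Clauses indexed by falsifying assignments; sign changes as symmetries\<close>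

text \<open>
  The clause on the variables \<open>S\<close> that is falsified exactly if \<open>S \<inter> X\<close> is the set of its true variables.
\<close>

definition clause_of :: "'x set \<Rightarrow> 'x set \<Rightarrow> 'x clause" where
  "clause_of S X = Neg ` (S \<inter> X) \<union> Pos ` (S - X)"

definition flip :: "'x set \<Rightarrow> 'x lit \<Rightarrow> 'x lit" where
  "flip P l = (if var l \<in> P then neg l else l)"

lemma clause_of_cong: "S \<inter> X = S \<inter> Y \<Longrightarrow> clause_of S X = clause_of S Y"
proof (rule set_eqI)
  fix l assume "S \<inter> X = S \<inter> Y"
  then have "x \<in> S \<Longrightarrow> x \<in> X \<longleftrightarrow> x \<in> Y" for x by blast
  then show "l \<in> clause_of S X \<longleftrightarrow> l \<in> clause_of S Y"
    by (cases l) (auto simp: clause_of_def)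
qed

lemma clause_of_empty [simp]: "clause_of {} X = {}"
  by (simp add: clause_of_def)

lemma neg_neg [simp]: "neg (neg l) = l"
  by (cases l) auto

lemma var_neg [simp]: "var (neg l) = var l"
  by (cases l) auto

lemma flip_flip [simp]: "flip P (flip P l) = l"
  by (auto simp: flip_def)

lemma neg_in_lits [simp]: "neg l \<in> lits A \<longleftrightarrow> l \<in> lits A"
  by (cases l) (auto simp: lits_def)

lemma flip_in_lits [simp]: "flip P l \<in> lits A \<longleftrightarrow> l \<in> lits A"
  by (auto simp: flip_def)

text \<open>On falsifying assignments a sign change acts as translation by \<open>P\<close> under
  symmetric difference, so applying the symmetry to a clause just shifts its index.\<close>

lemma flip_clause_of: "flip P ` clause_of S X = clause_of S (sym_diff X P)"
proof (rule set_eqI)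
  fix l
  have "l \<in> flip P ` clause_of S X \<longleftrightarrow> flip P l \<in> clause_of S X"
    by (metis flip_flip image_iff)
  also have "\<dots> \<longleftrightarrow> l \<in> clause_of S (sym_diff X P)"
    by (cases l) (auto simp: flip_def clause_of_def)
  finally show "l \<in> flip P ` clause_of S X \<longleftrightarrow> l \<in> clause_of S (sym_diff X P)" .
qed

lemma k_symmetry_flip:
  assumes "finite P" "card P \<le> k"
  shows "k_symmetry k A (flip P)"
proof -
  have "bij_betw (flip P) (lits A) (lits A)"
    by (rule bij_betw_byWitness[where f' = "flip P"]) auto
  moreover have "flip P (neg l) = neg (flip P l)" for l
    by (auto simp: flip_def)
  moreover have sub: "{x \<in> A. flip P (Pos x) \<noteq> Pos x} \<subseteq> P"
    by (auto simp: flip_def split: if_splits)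
  moreover have "card {x \<in> A. flip P (Pos x) \<noteq> Pos x} \<le> k"
    using card_mono[OF assms(1) sub] assms(2) by linarith
  ultimately show ?thesis
    unfolding k_symmetry_def using assms(1) finite_subset by blast
qed

text \<open>The falsifying assignments of the premises agree with \<open>X\<close> off the pivot
  \<open>x\<close>. It is false in the first, hence occurs positively there, and true in the
  second.\<close>

lemma resolvent_clause_of:
  assumes "x \<in> A" "x \<in> B"
  shows "resolvent x (clause_of A (X - {x})) (clause_of B (insert x X)) (clause_of (A \<union> B - {x}) X)"
  unfolding resolvent_def
proof (intro conjI set_eqI)
  fix l
  show "l \<in> clause_of (A \<union> B - {x}) X \<longleftrightarrow>
      l \<in> clause_of A (X - {x}) - {Pos x} \<union> (clause_of B (insert x X) - {Neg x})"
    by (cases l) (auto simp: clause_of_def)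
qed (use assms in \<open>auto simp: clause_of_def\<close>)

section \<open>Inference under extension and truncation of a proof\<close>

text \<open>The justification of entry \<open>i\<close> refers only to entries up to
  \<open>i\<close>. This serves both for appending clauses and for cutting a proof off after the
  empty clause.\<close>

lemma src2_inferred_cong:
  assumes "src2_inferred k F \<pi> i \<B>" "i < length \<pi>'" "\<And>j. j \<le> i \<Longrightarrow> \<pi>' ! j = \<pi> ! j"
  shows "src2_inferred k F \<pi>' i \<B>"
  using assms
proof (induction rule: src2_inferred.induct)
  case (input i)
  then show ?case using src2_inferred.input[of i \<pi>' F k] by simp
next
  case (resolution i j l \<B> \<C> x)
  show ?case
    by (rule src2_inferred.resolution[of i \<pi>' j l k F \<B> \<C> x]) (use resolution in auto)
next
  case (symmetry i j \<B> \<phi>)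
  show ?case
    by (rule src2_inferred.symmetry[of i \<pi>' j k F \<B> \<phi>]) (use symmetry in auto)
qed

lemma src2_inferred_less: "src2_inferred k F \<pi> i \<B> \<Longrightarrow> i < length \<pi>"
  by (cases rule: src2_inferred.cases) auto

lemma src2_inferred_append:
  "src2_inferred k F \<pi> i \<B> \<Longrightarrow> src2_inferred k F (\<pi> @ \<rho>) i \<B>"
  using src2_inferred_less[of k F \<pi> i \<B>] by (auto simp: nth_append intro: src2_inferred_cong)

lemma odd_card_sym_diff:
  assumes "finite A" "finite B"
  shows "odd (card (sym_diff A B)) \<longleftrightarrow> odd (card A) \<noteq> odd (card B)"
proof -
  have 1: "card (sym_diff A B) = card (A - B) + card (B - A)"
    using assms by (intro card_Un_disjoint) auto
  have 2: "card A = card (A - B) + card (A \<inter> B)"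
    using assms by (metis card_Diff_subset_Int card_mono finite_Int inf_le1 le_add_diff_inverse2)
  have 3: "card B = card (B - A) + card (A \<inter> B)"
    using assms by (metis card_Diff_subset_Int card_mono finite_Int inf_commute inf_le1 le_add_diff_inverse2)
  show ?thesis unfolding 1 2 3 by auto
qed

section \<open>Tseitin formulas with all charges 1 on a finite graph\<close>

locale tseitin_graph =
  fixes V :: "'v set" and E :: "'v set set"
  assumes finite_E: "finite E"
    and edge_ends: "e \<in> E \<Longrightarrow> \<exists>u v. u \<noteq> v \<and> e = {u, v}"
begin

abbreviation "F \<equiv> tseitin V E (\<lambda>_. 1)"

abbreviation "inc v \<equiv> incident E v"

text \<open>Since every charge is 1, the assignments violating the equation at \<open>v\<close> are
  those with an even number of true edges at \<open>v\<close>.\<close>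

definition axioms :: "'v set \<Rightarrow> 'v set cnf" where
  "axioms U = {clause_of (inc v) X | v X. v \<in> U \<and> even (card (inc v \<inter> X))}"

text \<open>These are the variables that survive in the sum of the equations of \<open>U\<close>: an
  edge with both ends in \<open>U\<close> occurs twice and cancels modulo 2.\<close>

definition cut :: "'v set \<Rightarrow> 'v set set" where
  "cut U = {e \<in> E. e \<inter> U \<noteq> {} \<and> \<not> e \<subseteq> U}"

text \<open>\<open>X\<close>, the set of edges with value 1, violates the sum of the equations of \<open>U\<close>.\<close>

definition violates :: "'v set \<Rightarrow> 'v set set \<Rightarrow> bool" where
  "violates U X \<longleftrightarrow> odd (card (cut U \<inter> X)) \<noteq> odd (card U)"

definition valid :: "'v set clause list \<Rightarrow> bool" where
  "valid \<pi> \<longleftrightarrow> (\<forall>i<length \<pi>. \<exists>\<B>. src2_inferred 3 F \<pi> i \<B>)"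

text \<open>
  A pair \<open>(C, U)\<close> records that \<open>C\<close> was inferred from clauses of vertices in \<open>U\<close> only, which is what
  makes the symmetry rule applicable to \<open>C\<close> for every symmetry preserving the equations of \<open>U\<close>.
\<close>

definition available :: "'v set clause list \<Rightarrow> ('v set clause \<times> 'v set) set" where
  "available \<pi> = {(C, U). \<exists>i \<B>. src2_inferred 3 F \<pi> i \<B> \<and> \<B> \<subseteq> axioms U \<and> C = \<pi> ! i}"

text \<open>A cost calculus for derivations: quantifying over all sequences in which
  \<open>T\<close> is available lets derivations be composed, with their costs adding up.\<close>

definition reach :: "nat \<Rightarrow> ('v set clause \<times> 'v set) set \<Rightarrow> ('v set clause \<times> 'v set) set \<Rightarrow> bool" where
  "reach c T T' \<longleftrightarrow> (\<forall>\<pi>. valid \<pi> \<and> T \<subseteq> available \<pi> \<longrightarrow>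
     (\<exists>\<rho>. valid (\<pi> @ \<rho>) \<and> length \<rho> \<le> c \<and> T' \<subseteq> available (\<pi> @ \<rho>)))"

text \<open>Only a part of the clauses encoding the summed constraint: cut edges outside
  \<open>W\<close> always occur positively. Hence there are at most \<open>2 ^ card W\<close>
  clauses, however large the cut is.\<close>

definition family :: "'v set \<Rightarrow> 'v set set \<Rightarrow> ('v set clause \<times> 'v set) set" where
  "family U W = (\<lambda>X. (clause_of (cut U) X, U)) ` {X. X \<subseteq> W \<and> violates U X}"

lemma finite_inc [simp]: "finite (inc v)"
  using finite_E by (simp add: incident_def)

lemma finite_cut [simp]: "finite (cut U)"
  using finite_E by (simp add: cut_def)

lemma axioms_subset: "U \<subseteq> V \<Longrightarrow> axioms U \<subseteq> F"
proof
  fix C assume "U \<subseteq> V" "C \<in> axioms U"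
  then obtain v X where v: "v \<in> V" and ev: "even (card (inc v \<inter> X))" and C: "C = clause_of (inc v) X"
    by (auto simp: axioms_def)
  let ?a = "\<lambda>e. of_bool (e \<in> X) :: bit"
  have "C = excluding_clause (inc v) ?a"
    unfolding C clause_of_def excluding_clause_def by (auto simp: image_iff)
  moreover have "(\<Sum>e\<in>inc v. ?a e) = of_nat (card (inc v \<inter> X))"
    by (simp add: sum.If_cases of_bool_def Int_def)
  then have "(\<Sum>e\<in>inc v. ?a e) \<noteq> 1"
    using ev by (auto elim!: evenE)
  ultimately show "C \<in> F"
    unfolding tseitin_def using v by blast
qed

lemma axioms_mono: "U \<subseteq> U' \<Longrightarrow> axioms U \<subseteq> axioms U'"
  by (auto simp: axioms_def)

lemma available_append: "available \<pi> \<subseteq> available (\<pi> @ \<rho>)"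
proof (clarsimp simp: available_def)
  fix U i \<B> assume *: "src2_inferred 3 F \<pi> i \<B>" "\<B> \<subseteq> axioms U"
  then show "\<exists>i' \<B>. src2_inferred 3 F (\<pi> @ \<rho>) i' \<B> \<and> \<B> \<subseteq> axioms U \<and> \<pi> ! i = (\<pi> @ \<rho>) ! i'"
    using src2_inferred_append[OF *(1)] src2_inferred_less[OF *(1)] by (metis nth_append)
qed

section \<open>Composition of derivations and their costs\<close>

lemma reach_single:
  assumes "\<And>\<pi>. valid \<pi> \<Longrightarrow> T \<subseteq> available \<pi> \<Longrightarrow>
    \<exists>\<B>. src2_inferred 3 F (\<pi> @ [C]) (length \<pi>) \<B> \<and> \<B> \<subseteq> axioms U"
  shows "reach 1 T {(C, U)}"
  unfolding reach_def
proof (intro allI impI, elim conjE)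
  fix \<pi> assume v: "valid \<pi>" and T: "T \<subseteq> available \<pi>"
  from assms[OF v T] obtain \<B> where \<B>: "src2_inferred 3 F (\<pi> @ [C]) (length \<pi>) \<B>" "\<B> \<subseteq> axioms U"
    by blast
  have "valid (\<pi> @ [C])"
    using v \<B>(1) src2_inferred_append[of 3 F \<pi> _ _ "[C]"]
    unfolding valid_def by (metis length_append_singleton less_Suc_eq)
  moreover have "(C, U) \<in> available (\<pi> @ [C])"
    unfolding available_def using \<B> by force
  ultimately show "\<exists>\<rho>. valid (\<pi> @ \<rho>) \<and> length \<rho> \<le> 1 \<and> {(C, U)} \<subseteq> available (\<pi> @ \<rho>)"
    by (intro exI[of _ "[C]"]) auto
qed

lemma reach_refl: "T' \<subseteq> T \<Longrightarrow> reach c T T'"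
  unfolding reach_def by (intro allI impI exI[of _ "[]"]) auto

lemma reach_mono: "reach c T T' \<Longrightarrow> c \<le> c' \<Longrightarrow> T \<subseteq> S \<Longrightarrow> S' \<subseteq> T' \<Longrightarrow> reach c' S S'"
proof -
  assume r: "reach c T T'" and le: "c \<le> c'" "T \<subseteq> S" "S' \<subseteq> T'"
  show "reach c' S S'"
    unfolding reach_def
  proof (intro allI impI, elim conjE)
    fix \<pi> assume "valid \<pi>" "S \<subseteq> available \<pi>"
    with r le(2) obtain \<rho> where "valid (\<pi> @ \<rho>)" "length \<rho> \<le> c" "T' \<subseteq> available (\<pi> @ \<rho>)"
      unfolding reach_def by blast
    then show "\<exists>\<rho>. valid (\<pi> @ \<rho>) \<and> length \<rho> \<le> c' \<and> S' \<subseteq> available (\<pi> @ \<rho>)"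
      using le by (intro exI[of _ \<rho>]) auto
  qed
qed

lemma reach_trans:
  assumes "reach c T T'" "reach c' T' T''"
  shows "reach (c + c') T T''"
  unfolding reach_def
proof (intro allI impI, elim conjE)
  fix \<pi> assume "valid \<pi>" "T \<subseteq> available \<pi>"
  with assms(1) obtain \<rho> where \<rho>: "valid (\<pi> @ \<rho>)" "length \<rho> \<le> c" "T' \<subseteq> available (\<pi> @ \<rho>)"
    unfolding reach_def by blast
  with assms(2) obtain \<sigma> where "valid (\<pi> @ \<rho> @ \<sigma>)" "length \<sigma> \<le> c'" "T'' \<subseteq> available (\<pi> @ \<rho> @ \<sigma>)"
    unfolding reach_def by (metis append_assoc)
  with \<rho> show "\<exists>\<rho>. valid (\<pi> @ \<rho>) \<and> length \<rho> \<le> c + c' \<and> T'' \<subseteq> available (\<pi> @ \<rho>)"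
    by (intro exI[of _ "\<rho> @ \<sigma>"]) auto
qed

lemma reach_keep:
  assumes "reach c T T'"
  shows "reach c T (T \<union> T')"
  unfolding reach_def
proof (intro allI impI, elim conjE)
  fix \<pi> assume "valid \<pi>" and T: "T \<subseteq> available \<pi>"
  with assms obtain \<rho> where "valid (\<pi> @ \<rho>)" "length \<rho> \<le> c" "T' \<subseteq> available (\<pi> @ \<rho>)"
    unfolding reach_def by blast
  moreover have "T \<subseteq> available (\<pi> @ \<rho>)" using T available_append by (rule order_trans)
  ultimately show "\<exists>\<rho>. valid (\<pi> @ \<rho>) \<and> length \<rho> \<le> c \<and> T \<union> T' \<subseteq> available (\<pi> @ \<rho>)"
    by blast
qed

text \<open>Available clauses stay available when the sequence grows, so two derivations from the
  same premises can be run one after the other.\<close>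

lemma reach_Un:
  assumes "reach c T T'" "reach c' T T''"
  shows "reach (c + c') T (T' \<union> T'')"
proof (rule reach_trans)
  show "reach c T (T \<union> T')" by (rule reach_keep) fact
  have "reach c' (T \<union> T') (T \<union> T' \<union> T'')"
    by (rule reach_keep, rule reach_mono[OF assms(2)]) auto
  then show "reach c' (T \<union> T') (T' \<union> T'')"
    by (rule reach_mono) auto
qed

lemma reach_finite:
  assumes "finite T'" "\<And>t. t \<in> T' \<Longrightarrow> reach c T {t}"
  shows "reach (c * card T') T T'"
  using assms
proof (induction T' rule: finite_induct)
  case empty
  then show ?case by (simp add: reach_refl)
next
  case (insert t T')
  then show ?case using reach_Un[of c T "{t}" "c * card T'" T'] by simp
qed

section \<open>The three inference rules in the cost calculus\<close>

lemma reach_axiom: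
  assumes "v \<in> V" "even (card (inc v \<inter> X))"
  shows "reach 1 T {(clause_of (inc v) X, {v})}"
proof (rule reach_single)
  fix \<pi>
  have C: "clause_of (inc v) X \<in> axioms {v}"
    using assms by (auto simp: axioms_def)
  with axioms_subset[of "{v}"] assms have "clause_of (inc v) X \<in> F" by auto
  then have "src2_inferred 3 F (\<pi> @ [clause_of (inc v) X]) (length \<pi>) {clause_of (inc v) X}"
    using src2_inferred.input[of "length \<pi>" "\<pi> @ [clause_of (inc v) X]" F 3] by simp
  with C show "\<exists>\<B>. src2_inferred 3 F (\<pi> @ [clause_of (inc v) X]) (length \<pi>) \<B> \<and> \<B> \<subseteq> axioms {v}"
    by blast
qed

lemma reach_resolve:
  assumes "x \<in> A" "x \<in> B" "(clause_of A (X - {x}), U) \<in> T" "(clause_of B (insert x X), U') \<in> T"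
  shows "reach 1 T {(clause_of (A \<union> B - {x}) X, U \<union> U')}" (is "reach 1 T {(?C, _)}")
proof (rule reach_single)
  fix \<pi> assume "T \<subseteq> available \<pi>"
  with assms have "(clause_of A (X - {x}), U) \<in> available \<pi>" "(clause_of B (insert x X), U') \<in> available \<pi>"
    by auto
  then obtain i j \<B> \<C> where
    i: "src2_inferred 3 F \<pi> i \<B>" "\<B> \<subseteq> axioms U" "clause_of A (X - {x}) = \<pi> ! i" and
    j: "src2_inferred 3 F \<pi> j \<C>" "\<C> \<subseteq> axioms U'" "clause_of B (insert x X) = \<pi> ! j"
    by (auto simp: available_def)
  have "src2_inferred 3 F (\<pi> @ [?C]) (length \<pi>) (\<B> \<union> \<C>)"
    using resolvent_clause_of[OF assms(1,2), of X] i j src2_inferred_less[OF i(1)] src2_inferred_less[OF j(1)]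
    by (intro src2_inferred.resolution[where j = i and l = j and x = x] src2_inferred_append)
      (auto simp: nth_append)
  moreover have "\<B> \<union> \<C> \<subseteq> axioms (U \<union> U')"
    using i(2) j(2) axioms_mono[of U "U \<union> U'"] axioms_mono[of U' "U \<union> U'"] by blast
  ultimately show "\<exists>\<B>. src2_inferred 3 F (\<pi> @ [?C]) (length \<pi>) \<B> \<and> \<B> \<subseteq> axioms (U \<union> U')"
    by blast
qed

text \<open>If \<open>P\<close> has an even number of edges at every vertex of \<open>U\<close>,
  then translation by \<open>P\<close> preserves the parity of the true edges there.\<close>

lemma flip_axioms:
  assumes "\<And>u. u \<in> U \<Longrightarrow> even (card (inc u \<inter> P))"
  shows "(`) (flip P) ` axioms U \<subseteq> axioms U"
proof (clarsimp simp: axioms_def flip_clause_of)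
  fix v X assume "v \<in> U" and ev: "even (card (inc v \<inter> X))"
  have eq: "inc v \<inter> sym_diff X P = sym_diff (inc v \<inter> X) (inc v \<inter> P)"
    by auto
  have "even (card (inc v \<inter> sym_diff X P))"
    unfolding eq using odd_card_sym_diff[of "inc v \<inter> X" "inc v \<inter> P"] ev assms[OF \<open>v \<in> U\<close>] by simp
  with \<open>v \<in> U\<close> show "\<exists>v' X'. clause_of (inc v) (X - P \<union> (P - X)) = clause_of (inc v') X' \<and>
      v' \<in> U \<and> even (card (inc v' \<inter> X'))"
    by blast
qed

text \<open>The image of the clauses used is again among the axioms of \<open>U\<close>, so the new
  clause is recorded with the same \<open>U\<close> and stays open to further symmetries.\<close>

lemma reach_flip:
  assumes "U \<subseteq> V" "finite P" "card P \<le> 3" "\<And>u. u \<in> U \<Longrightarrow> even (card (inc u \<inter> P))"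
    and "(clause_of S X, U) \<in> T"
  shows "reach 1 T {(clause_of S (sym_diff X P), U)}" (is "reach 1 T {(?C, _)}")
proof (rule reach_single)
  fix \<pi> assume "T \<subseteq> available \<pi>"
  with assms have "(clause_of S X, U) \<in> available \<pi>"
    by auto
  then obtain i \<B> where
    i: "src2_inferred 3 F \<pi> i \<B>" "\<B> \<subseteq> axioms U" "clause_of S X = \<pi> ! i"
    by (auto simp: available_def)
  have sub: "(`) (flip P) ` \<B> \<subseteq> axioms U"
    using flip_axioms[of U P] assms(4) i(2) by blast
  have "src2_inferred 3 F (\<pi> @ [?C]) (length \<pi>) ((`) (flip P) ` \<B>)"
  proof (rule src2_inferred.symmetry[where j = i])
    show "k_symmetry 3 (vars F) (flip P)" using assms by (intro k_symmetry_flip)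
    show "\<B> \<subseteq> F" "(`) (flip P) ` \<B> \<subseteq> F" using axioms_subset[OF assms(1)] i(2) sub by auto
  qed (use i src2_inferred_less[OF i(1)] src2_inferred_append[OF i(1)] in
      \<open>auto simp: nth_append flip_clause_of[symmetric]\<close>)
  with sub show "\<exists>\<B>. src2_inferred 3 F (\<pi> @ [?C]) (length \<pi>) \<B> \<and> \<B> \<subseteq> axioms U"
    by blast
qed

section \<open>Adding the equation of one vertex\<close>

text \<open>
  For a sum of two equations over \<open>S\<close> and \<open>I\<close>, every assignment violating the sum violates exactly one
  of them; \<open>P\<close> tells which.
\<close>

lemma reach_eliminate:
  assumes "finite K" "K \<noteq> {}" "K \<subseteq> S" "K \<subseteq> I"
    and "\<And>x Y. x \<in> K \<Longrightarrow> P (insert x Y) \<noteq> P (Y - {x})"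
    and "\<And>Y. Y - K = X - K \<Longrightarrow> P Y \<Longrightarrow> (clause_of S Y, U) \<in> T"
    and "\<And>Y. Y - K = X - K \<Longrightarrow> \<not> P Y \<Longrightarrow> reach 1 T {(clause_of I Y, {v})}"
  shows "reach (3 ^ card K) T {(clause_of (S \<union> I - K) X, insert v U)}"
  using assms
proof (induction K arbitrary: X rule: finite_ne_induct)
  case (singleton x)
  have ag: "insert x X - {x} = X - {x}" "X - {x} - {x} = X - {x}" by auto
  have "reach (1 + 1) T {(clause_of (S \<union> I - {x}) X, insert v U)}"
  \<comment> \<open>Setting \<open>x\<close> to true or to false switches which of the two equations
    is violated. So one premise comes from \<open>S\<close> and the other from \<open>I\<close>; the
    case decides which has the positive literal.\<close>
  proof (cases "P (insert x X)")
    case True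
    then have "\<not> P (X - {x})" using singleton.prems(3) by blast
    then have "reach 1 T {(clause_of I (X - {x}), {v})}"
      using singleton.prems(5)[OF ag(2)] by blast
    then have r1: "reach 1 T (T \<union> {(clause_of I (X - {x}), {v})})" by (rule reach_keep)
    have r2: "reach 1 (T \<union> {(clause_of I (X - {x}), {v})}) {(clause_of (I \<union> S - {x}) X, {v} \<union> U)}"
      using singleton.prems True ag by (intro reach_resolve) auto
    have "I \<union> S - {x} = S \<union> I - {x}" "{v} \<union> U = insert v U" by auto
    with reach_trans[OF r1 r2] show ?thesis by (simp only:)
  next
    case False
    then have "P (X - {x})" using singleton.prems(3) by blast
    have "reach 1 T {(clause_of I (insert x X), {v})}"
      using singleton.prems(5)[OF ag(1)] False by blast
    then have r1: "reach 1 T (T \<union> {(clause_of I (insert x X), {v})})" by (rule reach_keep)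
    have r2: "reach 1 (T \<union> {(clause_of I (insert x X), {v})}) {(clause_of (S \<union> I - {x}) X, U \<union> {v})}"
      using singleton.prems \<open>P (X - {x})\<close> ag by (intro reach_resolve) auto
    have "U \<union> {v} = insert v U" by auto
    with reach_trans[OF r1 r2] show ?thesis by (simp only:)
  qed
  then show ?case by (rule reach_mono) auto
next
  case (insert x K)
  let ?R = "S \<union> I - K"
  \<comment> \<open>The edges of \<open>K\<close> are eliminated first, for both values of
    \<open>x\<close>; the last resolution is on \<open>x\<close>.\<close>
  have r: "reach (3 ^ card K) T {(clause_of ?R Z, insert v U)}" if "Z - {x} = X - {x}" for Z
  proof (rule insert.IH)
    fix Y assume "Y - K = Z - K"
    with that have "Y - insert x K = X - insert x K" by blast
    note prems = insert.prems(4)[OF this] insert.prems(5)[OF this]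
    show "P Y \<Longrightarrow> (clause_of S Y, U) \<in> T" by (rule prems(1))
    show "\<not> P Y \<Longrightarrow> reach 1 T {(clause_of I Y, {v})}" by (rule prems(2))
  next
    show "K \<subseteq> S" "K \<subseteq> I" using insert.prems(1,2) by auto
    show "P (insert y Y) \<noteq> P (Y - {y})" if "y \<in> K" for y Y using insert.prems(3) that by blast
  qed
  have r1: "reach (3 ^ card K + 3 ^ card K) T
      ({(clause_of ?R (X - {x}), insert v U)} \<union> {(clause_of ?R (insert x X), insert v U)})"
    by (intro reach_Un r) auto
  have "x \<in> ?R" using insert.hyps(3) insert.prems(1) by blast
  then have r2: "reach 1 ({(clause_of ?R (X - {x}), insert v U)} \<union> {(clause_of ?R (insert x X), insert v U)})
      {(clause_of (?R \<union> ?R - {x}) X, insert v U \<union> insert v U)}"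
    by (intro reach_resolve) auto
  have eq: "?R \<union> ?R - {x} = S \<union> I - insert x K" by auto
  \<comment> \<open>The base 3 absorbs the final resolution: two subderivations and one further step
    cost \<open>2 * 3 ^ card K + 1\<close>.\<close>
  have "(3::nat) ^ card K \<ge> 1" by simp
  then have le: "3 ^ card K + 3 ^ card K + 1 \<le> (3::nat) ^ card (insert x K)"
    using insert.hyps by simp
  from reach_trans[OF r1 r2] show ?case
    unfolding eq by (rule reach_mono) (use le in auto)
qed

text \<open>An edge at \<open>v\<close> leaves the cut if its other end is in \<open>U\<close> and
  enters it otherwise. That the two ends differ matters here.\<close>

lemma cut_insert:
  assumes "v \<notin> U"
  shows "cut (insert v U) = sym_diff (cut U) (inc v)"
proof -
  have "e \<in> cut (insert v U) \<longleftrightarrow> (e \<in> cut U) \<noteq> (e \<in> inc v)" if "e \<in> E" for e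
    using edge_ends[OF that] assms that by (auto simp: cut_def incident_def)
  then show ?thesis by (auto simp: cut_def incident_def)
qed

text \<open>A sum of two equations modulo 2 is violated iff exactly one of them is; the one at
  \<open>v\<close> holds iff the number of true edges there is odd.\<close>

lemma violates_insert:
  assumes "v \<notin> U" "finite U"
  shows "violates (insert v U) X \<longleftrightarrow> (violates U X \<longleftrightarrow> odd (card (inc v \<inter> X)))"
proof -
  have eq: "cut (insert v U) \<inter> X = sym_diff (cut U \<inter> X) (inc v \<inter> X)"
    unfolding cut_insert[OF assms(1)] by auto
  show ?thesis
    unfolding violates_def eq using odd_card_sym_diff[of "cut U \<inter> X" "inc v \<inter> X"] assms by auto
qed

lemma violates_cong: "cut U \<inter> X = cut U \<inter> Y \<Longrightarrow> violates U X = violates U Y"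
  by (simp add: violates_def)

lemma cut_empty [simp]: "cut {} = {}"
  by (simp add: cut_def)

text \<open>The edges between \<open>v\<close> and \<open>U\<close> are resolved away. With
  \<open>U = {}\<close> there is nothing to resolve with, and the clause is already an input clause
  at \<open>v\<close>.\<close>

lemma reach_add_vertex:
  assumes U: "finite U" "v \<in> V" "v \<notin> U" "cut U \<inter> inc v \<noteq> {} \<or> U = {}"
    and X: "violates (insert v U) X"
    and T: "\<And>Y. Y - cut U \<inter> inc v = X - cut U \<inter> inc v \<Longrightarrow> violates U Y \<Longrightarrow> (clause_of (cut U) Y, U) \<in> T"
  shows "reach (3 ^ card (cut U \<inter> inc v)) T {(clause_of (cut (insert v U)) X, insert v U)}"
proof (cases "U = {}")
  case True
  have "cut {v} = inc v" using cut_insert[of v "{}"] by simp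
  moreover have "even (card (inc v \<inter> X))"
    using X True unfolding violates_def \<open>U = {}\<close> by (simp add: \<open>cut {v} = inc v\<close>)
  ultimately show ?thesis using reach_axiom[OF U(2), of X T] True by simp
next
  case False
  let ?K = "cut U \<inter> inc v"
  have "reach (3 ^ card ?K) T {(clause_of (cut U \<union> inc v - ?K) X, insert v U)}"
  proof (rule reach_eliminate[where P = "violates U"])
    show "?K \<noteq> {}" using U(4) False by blast
    fix x Y assume "x \<in> ?K"
    then have "cut U \<inter> insert x Y = insert x (cut U \<inter> (Y - {x}))" by auto
    then have "card (cut U \<inter> insert x Y) = Suc (card (cut U \<inter> (Y - {x})))" by simp
    then show "violates U (insert x Y) \<noteq> violates U (Y - {x})" by (auto simp: violates_def)
  next
    fix Y assume Y: "Y - ?K = X - ?K" "\<not> violates U Y"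
    have "cut (insert v U) \<inter> Y = cut (insert v U) \<inter> X"
      using Y(1) unfolding cut_insert[OF U(3)] by blast
    then have "violates (insert v U) Y" using X violates_cong by blast
    then have "even (card (inc v \<inter> Y))" using Y(2) violates_insert[OF U(3,1)] by blast
    then show "reach 1 T {(clause_of (inc v) Y, {v})}" using U(2) by (intro reach_axiom)
  qed (use T in auto)
  moreover have "cut U \<union> inc v - ?K = cut (insert v U)" unfolding cut_insert[OF U(3)] by auto
  ultimately show ?thesis by simp
qed

section \<open>Families of clauses with a bounded set of varied signs\<close>

lemma finite_family: "finite W \<Longrightarrow> finite (family U W)"
  unfolding family_def by (intro finite_imageI) (rule finite_subset[of _ "Pow W"], auto)

lemma card_family:
  assumes "finite W"
  shows "card (family U W) \<le> 2 ^ card W"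
proof -
  have "card (family U W) \<le> card {X. X \<subseteq> W \<and> violates U X}"
    unfolding family_def by (intro card_image_le) (rule finite_subset[of _ "Pow W"], use assms in auto)
  also have "\<dots> \<le> card (Pow W)"
    using assms by (intro card_mono) auto
  finally show ?thesis using assms by (simp add: card_Pow)
qed

lemma in_familyI:
  assumes "cut U \<inter> X \<subseteq> W" "violates U X"
  shows "(clause_of (cut U) X, U) \<in> family U W"
proof -
  have "clause_of (cut U) X = clause_of (cut U) (cut U \<inter> X)" by (rule clause_of_cong) auto
  moreover have "violates U (cut U \<inter> X)" using assms(2) violates_cong[of U X "cut U \<inter> X"] by auto
  ultimately show ?thesis unfolding family_def using assms(1) by blast
qed

text \<open>The premises for a new clause have their true cut edges either among those eliminated or
  in \<open>W'\<close>, and \<open>W\<close> contains both kinds. At most \<open>2 ^ m\<close>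
  clauses are needed, each at cost at most \<open>3 ^ d\<close>.\<close>

lemma family_add_vertex:
  assumes U: "finite U" "v \<in> V" "v \<notin> U" "cut U \<inter> inc v \<noteq> {} \<or> U = {}"
    and "finite W'" "card W' \<le> m" "card (inc v) \<le> d"
    and W: "cut U \<inter> inc v \<subseteq> W" "W' \<inter> cut U \<subseteq> W"
  shows "reach (3 ^ d * 2 ^ m) (family U W) (family (insert v U) W')"
proof -
  let ?K = "cut U \<inter> inc v"
  have "reach (3 ^ card ?K) (family U W) {t}" if "t \<in> family (insert v U) W'" for t
  proof -
    from that obtain X where X: "t = (clause_of (cut (insert v U)) X, insert v U)" "X \<subseteq> W'"
      "violates (insert v U) X" by (auto simp: family_def)
    show ?thesis unfolding X(1)
    proof (rule reach_add_vertex[OF U X(3)])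
      fix Y assume Y: "Y - ?K = X - ?K" "violates U Y"
      have "cut U \<inter> Y \<subseteq> W" using Y(1) W X(2) by blast
      then show "(clause_of (cut U) Y, U) \<in> family U W" using Y(2) by (rule in_familyI)
    qed
  qed
  then have "reach (3 ^ card ?K * card (family (insert v U) W')) (family U W) (family (insert v U) W')"
    using assms(5) by (intro reach_finite finite_family)
  moreover have "card ?K \<le> d"
    using card_mono[of "inc v" ?K] assms(7) by simp
  then have "(3::nat) ^ card ?K \<le> 3 ^ d" by (rule power_increasing) simp
  moreover have "card (family (insert v U) W') \<le> 2 ^ m"
    using card_family[OF assms(5), of "insert v U"] power_increasing[OF assms(6), of "2::nat"] by linarith
  ultimately show ?thesis
    by (elim reach_mono mult_le_mono) auto
qed

text \<open>A clause with \<open>{b, q}\<close> true is the flip along the path of one with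
  \<open>{b, q}\<close> false. The flip also changes \<open>{a, p}\<close>, which is harmless
  because that edge is in \<open>W\<close>.\<close>

lemma family_enlarge:
  assumes U: "U \<subseteq> V" "a \<in> U" "b \<in> U" "a \<noteq> b" "p \<notin> U" "q \<notin> U"
    and E: "{a, p} \<in> E" "{a, b} \<in> E" "{b, q} \<in> E"
    and W: "{a, p} \<in> W" "finite W" "card W \<le> m"
  shows "reach (2 ^ Suc m) (family U W) (family U (insert {b, q} W))"
proof -
  define P where "P = {{a, p}, {a, b}, {b, q}}"
  define D where "D = {{a, p}, {b, q}}"
  let ?W = "insert {b, q} W"
  \<comment> \<open>The ends of the path lie outside \<open>U\<close>, so a vertex of
    \<open>U\<close> meets two of its edges or none.\<close>
  have ev: "even (card (inc u \<inter> P))" if "u \<in> U" for u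
  proof -
    consider "u = a" | "u = b" | "u \<noteq> a" "u \<noteq> b" by blast
    then show ?thesis
    proof cases
      case 1
      then have "inc u \<inter> P = {{a, p}, {a, b}}" using E U by (auto simp: incident_def P_def)
      moreover have "{a, p} \<noteq> {a, b}" using U by (auto simp: doubleton_eq_iff)
      ultimately show ?thesis by simp
    next
      case 2
      then have "inc u \<inter> P = {{a, b}, {b, q}}" using E U by (auto simp: incident_def P_def)
      moreover have "{a, b} \<noteq> {b, q}" using U by (auto simp: doubleton_eq_iff)
      ultimately show ?thesis by simp
    next
      case 3
      then have "inc u \<inter> P = {}" using U that by (auto simp: incident_def P_def)
      then show ?thesis by simp
    qed
  qed
  have P: "finite P" "card P \<le> 3"
    by (simp_all add: card_insert_if P_def)
  \<comment> \<open>The middle edge \<open>{a, b}\<close> is inside \<open>U\<close>; the flip thus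
    changes exactly two cut variables and keeps the parity.\<close>
  have cutP: "cut U \<inter> P = D" using U E by (auto simp: cut_def P_def D_def)
  then have "{b, q} \<in> cut U" by (auto simp: D_def)
  have "{a, p} \<noteq> {b, q}" using U by (auto simp: doubleton_eq_iff)
  then have D: "finite D" "even (card D)" by (simp_all add: D_def)
  have "reach 1 (family U W) {t}" if t: "t \<in> family U ?W" for t
  proof -
    from t obtain X where X: "t = (clause_of (cut U) X, U)" "X \<subseteq> ?W" "violates U X"
      by (auto simp: family_def)
    show ?thesis
    proof (cases "{b, q} \<in> X")
      case False
      then have "t \<in> family U W" using X by (auto simp: family_def)
      then show ?thesis by (intro reach_refl) auto
    next
      case True
      let ?Y = "sym_diff X P"
      have eq: "cut U \<inter> ?Y = sym_diff (cut U \<inter> X) D"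
        using cutP by blast
      have "odd (card (cut U \<inter> ?Y)) = odd (card (cut U \<inter> X))"
        unfolding eq using odd_card_sym_diff[of "cut U \<inter> X" D] D by simp
      then have "violates U ?Y" using X(3) by (simp add: violates_def)
      moreover have "cut U \<inter> ?Y \<subseteq> W"
        unfolding eq using X(2) W(1) True \<open>{b, q} \<in> cut U\<close> by (auto simp: D_def)
      ultimately have "(clause_of (cut U) ?Y, U) \<in> family U W" by (rule in_familyI[rotated])
      then have "reach 1 (family U W) {(clause_of (cut U) (sym_diff ?Y P), U)}"
        using U(1) ev P by (intro reach_flip) auto
      moreover have "sym_diff ?Y P = X" by blast
      ultimately show ?thesis using X(1) by simp
    qed
  qed
  then have "reach (1 * card (family U ?W)) (family U W) (family U ?W)"
    using W by (intro reach_finite finite_family) auto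
  moreover have "card ?W \<le> Suc m" using W by (simp add: card_insert_if)
  then have "card (family U ?W) \<le> 2 ^ Suc m"
    using card_family[of ?W U] W(2) power_increasing[of "card ?W" "Suc m" "2::nat"] by simp
  ultimately show ?thesis by (elim reach_mono) auto
qed

section \<open>From derivations to proof size\<close>

lemma src2_size_le:
  assumes "reach c {} {({}, U)}"
  shows "src2_size 3 F \<le> enat c"
proof -
  have "valid []" by (simp add: valid_def)
  with assms obtain \<pi> where \<pi>: "valid \<pi>" "length \<pi> \<le> c" "({}, U) \<in> available \<pi>"
    unfolding reach_def by fastforce
  then obtain i \<B> where i: "src2_inferred 3 F \<pi> i \<B>" "\<pi> ! i = {}"
    by (auto simp: available_def)
  have less: "i < length \<pi>" using src2_inferred_less[OF i(1)] .
  \<comment> \<open>Availability does not place the empty clause last, so the sequence is cut off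
    right after it.\<close>
  let ?\<pi> = "take (Suc i) \<pi>"
  have "src2_proof 3 F ?\<pi>"
    unfolding src2_proof_def
  proof (intro conjI allI impI)
    show "?\<pi> \<noteq> []" using less by auto
    show "last ?\<pi> = {}" using less i(2) by (simp add: take_Suc_conv_app_nth)
    fix j assume j: "j < length ?\<pi>"
    then obtain \<C> where "src2_inferred 3 F \<pi> j \<C>" using \<pi>(1) by (auto simp: valid_def)
    then have "src2_inferred 3 F ?\<pi> j \<C>"
      by (rule src2_inferred_cong) (use j in auto)
    then show "\<exists>\<B>. src2_inferred 3 F ?\<pi> j \<B>" ..
  qed
  then have "src2_size 3 F \<le> enat (length ?\<pi>)"
    unfolding src2_size_def by (intro INF_lower) simp
  also have "\<dots> \<le> enat c" using \<pi>(2) by simp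
  finally show ?thesis .
qed

end

section \<open>Neighbourhoods in the toroidal grid\<close>

locale torus =
  fixes n :: nat
  assumes n_ge_3: "n \<ge> 3"
begin

definition succ :: "nat \<Rightarrow> nat" where
  "succ a = (if Suc a = n then 0 else Suc a)"

definition pred :: "nat \<Rightarrow> nat" where
  "pred a = (if a = 0 then n - 1 else a - 1)"

lemma succ_eq: "a < n \<Longrightarrow> Suc a mod n = succ a"
  by (auto simp: succ_def)

lemma pred_eqI: "c < n \<Longrightarrow> a = succ c \<Longrightarrow> c = pred a"
  by (auto simp: succ_def pred_def split: if_splits)

lemma succ_less: "a < n \<Longrightarrow> succ a < n"
  by (auto simp: succ_def)

lemma torus_edges_eq:
  "torus_edges n = {{(a, b), (succ a, b)} |a b. a < n \<and> b < n} \<union> {{(a, b), (a, succ b)} |a b. a < n \<and> b < n}"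
proof -
  have "(\<lambda>(i, j). {(i, j), (Suc i mod n, j)}) ` torus_vertices n = {{(a, b), (succ a, b)} |a b. a < n \<and> b < n}"
    using succ_eq unfolding torus_vertices_def by (force simp: image_iff)
  moreover have "(\<lambda>(i, j). {(i, j), (i, Suc j mod n)}) ` torus_vertices n = {{(a, b), (a, succ b)} |a b. a < n \<and> b < n}"
    using succ_eq unfolding torus_vertices_def by (force simp: image_iff)
  ultimately show ?thesis
    unfolding torus_edges_def by simp
qed

lemma edge_vertical: "a < n \<Longrightarrow> b < n \<Longrightarrow> {(a, b), (succ a, b)} \<in> torus_edges n"
  and edge_horizontal: "a < n \<Longrightarrow> b < n \<Longrightarrow> {(a, b), (a, succ b)} \<in> torus_edges n"
  unfolding torus_edges_eq by blast+

sublocale tseitin_graph "torus_vertices n" "torus_edges n"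
proof
  show "finite (torus_edges n)"
    by (simp add: torus_edges_def torus_vertices_def)
  fix e assume "e \<in> torus_edges n"
  moreover have "succ a \<noteq> a" for a
    using n_ge_3 by (auto simp: succ_def)
  ultimately show "\<exists>u v. u \<noteq> v \<and> e = {u, v}"
    unfolding torus_edges_eq by (auto; metis Pair_inject)
qed

lemma inc_cases:
  assumes "e \<in> inc (a, b)"
  obtains "a < n" "b < n" "e = {(a, b), (succ a, b)}" | "a < n" "b < n" "e = {(a, b), (pred a, b)}"
  | "a < n" "b < n" "e = {(a, b), (a, succ b)}" | "a < n" "b < n" "e = {(a, b), (a, pred b)}"
proof -
  from assms have e: "e \<in> torus_edges n" and ab: "(a, b) \<in> e" by (auto simp: incident_def)
  from e consider (v) c d where "c < n" "d < n" "e = {(c, d), (succ c, d)}"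
    | (h) c d where "c < n" "d < n" "e = {(c, d), (c, succ d)}"
    unfolding torus_edges_eq by blast
  then show thesis
  proof cases
    case v
    show thesis
    proof (cases "(a, b) = (c, d)")
      case True
      with v show ?thesis by (intro that(1)) auto
    next
      case False
      with v ab have "a = succ c" "b = d" by auto
      with v succ_less[of c] pred_eqI[of c a] show ?thesis by (intro that(2)) auto
    qed
  next
    case h
    show thesis
    proof (cases "(a, b) = (c, d)")
      case True
      with h show ?thesis by (intro that(3)) auto
    next
      case False
      with h ab have "a = c" "b = succ d" by auto
      with h succ_less[of d] pred_eqI[of d b] show ?thesis by (intro that(4)) auto
    qed
  qed
qed

lemma card_inc: "card (inc v) \<le> 4"
proof (cases v)
  case (Pair a b)
  \<comment> \<open>A list instead of a set: its length bounds the number of elements without any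
    proof of distinctness.\<close>
  let ?S = "[{(a, b), (succ a, b)}, {(a, b), (pred a, b)}, {(a, b), (a, succ b)}, {(a, b), (a, pred b)}]"
  have "inc v \<subseteq> set ?S"
  proof
    fix e assume "e \<in> inc v"
    then show "e \<in> set ?S" unfolding Pair by (cases rule: inc_cases) simp_all
  qed
  then have "card (inc v) \<le> card (set ?S)" by (intro card_mono) auto
  also have "\<dots> \<le> 4" using card_length[of ?S] by simp
  finally show ?thesis .
qed

section \<open>Sweeping the grid row by row\<close>

definition prefix :: "nat \<Rightarrow> nat \<Rightarrow> (nat \<times> nat) set" where
  "prefix i j = {(a, b). a < n \<and> b < n \<and> (a < i \<or> a = i \<and> b < j)}"

definition carry :: "nat \<Rightarrow> nat \<Rightarrow> (nat \<times> nat) set set" where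
  "carry i j = cut (prefix i j) \<inter> (inc (i, j) \<union> inc (i, 0) \<union> inc (0, 0))"

abbreviation stage :: "nat \<Rightarrow> nat \<Rightarrow> ((nat \<times> nat) set clause \<times> (nat \<times> nat) set) set" where
  "stage i j \<equiv> family (prefix i j) (carry i j)"

text \<open>Enlarging 12 and then 13 carried edges by one, followed by adding a vertex of degree at
  most 4 with at most 12 edges carried on. The value is independent of \<open>n\<close>.\<close>

definition step_cost :: nat where
  "step_cost = 2 ^ 13 + 2 ^ 14 + 3 ^ 4 * 2 ^ 12"

lemma prefix_subset: "prefix i j \<subseteq> torus_vertices n"
  by (auto simp: prefix_def torus_vertices_def)

lemma finite_prefix: "finite (prefix i j)"
  using prefix_subset by (rule finite_subset) (simp add: torus_vertices_def)

lemma finite_carry: "finite (carry i j)"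
  by (simp add: carry_def)

lemma card_carry: "card (carry i j) \<le> 12"
proof -
  have "card (carry i j) \<le> card (inc (i, j) \<union> inc (i, 0) \<union> inc (0, 0))"
    unfolding carry_def by (intro card_mono) auto
  also have "\<dots> \<le> card (inc (i, j)) + card (inc (i, 0)) + card (inc (0, 0))"
    by (meson add_le_mono card_Un_le order_refl order_trans)
  also have "\<dots> \<le> 12"
    using card_inc[of "(i, j)"] card_inc[of "(i, 0)"] card_inc[of "(0, 0)"] by linarith
  finally show ?thesis .
qed

lemma edge_below: "0 < i \<Longrightarrow> i < n \<Longrightarrow> j < n \<Longrightarrow> {(i - 1, j), (i, j)} \<in> torus_edges n"
  using edge_vertical[of "i - 1" j] by (simp add: succ_def)

lemma edge_left: "0 < j \<Longrightarrow> j < n \<Longrightarrow> i < n \<Longrightarrow> {(i, j - 1), (i, j)} \<in> torus_edges n"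
  using edge_horizontal[of i "j - 1"] by (simp add: succ_def)

lemma edge_wrap: "Suc i = n \<Longrightarrow> j < n \<Longrightarrow> {(0, j), (i, j)} \<in> torus_edges n"
  using edge_vertical[of i j] by (simp add: succ_def insert_commute)

text \<open>Every vertex but the first has its predecessor in the column or in the row among those
  treated, so there is an edge to resolve on.\<close>

lemma add_vertex:
  assumes "i < n" "j < n" "W' \<inter> cut (prefix i j) \<subseteq> W" "carry i j \<subseteq> W"
    and "finite W'" "card W' \<le> 12"
  shows "reach (3 ^ 4 * 2 ^ 12) (family (prefix i j) W) (family (insert (i, j) (prefix i j)) W')"
proof (rule family_add_vertex)
  show "cut (prefix i j) \<inter> inc (i, j) \<noteq> {} \<or> prefix i j = {}"
  proof -
    consider "0 < i" | "0 < j" | "i = 0" "j = 0" by blast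
    then show ?thesis
    proof cases
      case 1
      then have "{(i - 1, j), (i, j)} \<in> cut (prefix i j) \<inter> inc (i, j)"
        using edge_below[of i j] assms by (auto simp: cut_def incident_def prefix_def)
      then show ?thesis by blast
    next
      case 2
      then have "{(i, j - 1), (i, j)} \<in> cut (prefix i j) \<inter> inc (i, j)"
        using edge_left[of j i] assms by (auto simp: cut_def incident_def prefix_def)
      then show ?thesis by blast
    next
      case 3
      then show ?thesis by (simp add: prefix_def)
    qed
  qed
  show "cut (prefix i j) \<inter> inc (i, j) \<subseteq> W" using assms(4) by (auto simp: carry_def)
qed (use assms finite_prefix card_inc in \<open>auto simp: prefix_def torus_vertices_def\<close>)

text \<open>The path runs from \<open>(i, j)\<close> via \<open>(r, j)\<close> and
  \<open>(r, Suc j)\<close> to \<open>(i, Suc j)\<close>. It is used with \<open>r = i - 1\<close>,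
  and in the last row also with \<open>r = 0\<close>.\<close>

lemma enlarge:
  assumes "0 < i" "i < n" "Suc j < n" "r < i" "{(r, j), (i, j)} \<in> torus_edges n"
    "{(r, Suc j), (i, Suc j)} \<in> torus_edges n"
    and "carry i j \<subseteq> W" "finite W" "card W \<le> m"
  shows "reach (2 ^ Suc m) (family (prefix i j) W)
    (family (prefix i j) (insert {(r, Suc j), (i, Suc j)} W))"
proof (rule family_enlarge[where a = "(r, j)" and p = "(i, j)"])
  show "{(r, j), (r, Suc j)} \<in> torus_edges n"
    using edge_horizontal[of r j] assms by (simp add: succ_def)
  have "{(r, j), (i, j)} \<in> carry i j"
    using assms by (auto simp: carry_def cut_def prefix_def incident_def)
  then show "{(r, j), (i, j)} \<in> W" using assms by blast
qed (use assms prefix_subset in \<open>auto simp: prefix_def\<close>)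

lemma reach_next:
  assumes "i < n" "Suc j < n"
  shows "reach step_cost (stage i j) (stage i (Suc j))"
proof -
  let ?U = "prefix i j" and ?x = "{(i - 1, Suc j), (i, Suc j)}" and ?d = "{(0, Suc j), (i, Suc j)}"
  define W where "W = (if i = 0 then carry i j else insert ?x (carry i j))"
  define W2 where "W2 = (if Suc i = n then insert ?d W else W)"
  have W: "carry i j \<subseteq> W" "finite W" "card W \<le> 13"
    using finite_carry[of i j] card_carry[of i j] by (auto simp: W_def card_insert_if)
  have r1: "reach (2 ^ 13) (stage i j) (family ?U W)"
  proof (cases "i = 0")
    case True
    then show ?thesis by (simp add: W_def reach_refl)
  next
    case False
    then have "reach (2 ^ Suc 12) (stage i j) (family ?U (insert ?x (carry i j)))"
      using assms card_carry finite_carry by (intro enlarge edge_below) auto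
    then show ?thesis using False by (simp add: W_def)
  qed
  have r2: "reach (2 ^ 14) (family ?U W) (family ?U W2)"
  proof (cases "Suc i = n")
    case False
    then show ?thesis by (simp add: W2_def reach_refl)
  next
    case True
    then have "reach (2 ^ Suc 13) (family ?U W) (family ?U (insert ?d W))"
      using assms W n_ge_3 by (intro enlarge edge_wrap) auto
    then show ?thesis using True by (simp add: W2_def)
  qed
  have r3: "reach (3 ^ 4 * 2 ^ 12) (family ?U W2) (family (insert (i, j) ?U) (carry i (Suc j)))"
  proof (rule add_vertex)
    \<comment> \<open>Of the edges at \<open>(i, Suc j)\<close>, the one to row \<open>i - 1\<close>
      is \<open>?x\<close> and a wrapping one to row 0 is \<open>?d\<close>. A wrapping horizontal
      edge ends at \<open>(i, 0)\<close> and is carried already, and the left neighbour is not yet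
      in \<open>?U\<close>.\<close>
    show "carry i (Suc j) \<inter> cut ?U \<subseteq> W2"
    proof
      fix e assume e: "e \<in> carry i (Suc j) \<inter> cut ?U"
      show "e \<in> W2"
      proof (cases "e \<in> inc (i, 0) \<union> inc (0, 0)")
        case True
        then have "e \<in> carry i j" using e by (auto simp: carry_def)
        then show ?thesis using W(1) by (auto simp: W2_def)
      next
        case False
        then have "e \<in> inc (i, Suc j)" using e by (auto simp: carry_def)
        then show ?thesis
        proof (cases rule: inc_cases)
          case 1
          then have "succ i < i" using e by (auto simp: cut_def prefix_def)
          then have "Suc i = n" "succ i = 0" by (auto simp: succ_def split: if_splits)
          then show ?thesis using 1 by (simp add: W2_def insert_commute)
        next
          case 2
          then have "pred i < i" using e by (auto simp: cut_def prefix_def)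
          then have "i \<noteq> 0" "pred i = i - 1" using assms by (auto simp: pred_def)
          then show ?thesis using 2 by (simp add: W2_def W_def insert_commute)
        next
          case 3
          then have "succ (Suc j) < j" using e by (auto simp: cut_def prefix_def)
          then have "succ (Suc j) = 0" by (auto simp: succ_def split: if_splits)
          then have "e \<in> inc (i, 0)" using 3 e by (auto simp: cut_def incident_def)
          then show ?thesis using False by blast
        next
          case 4
          then show ?thesis using e by (auto simp: cut_def prefix_def pred_def)
        qed
      qed
    qed
  qed (use assms W card_carry finite_carry in \<open>auto simp: W2_def\<close>)
  have "insert (i, j) ?U = prefix i (Suc j)"
    using assms by (auto simp: prefix_def)
  with reach_trans[OF reach_trans[OF r1 r2] r3] show ?thesis
    by (simp only: step_cost_def)
qed

text \<open>No symmetry is applied here: an edge joining \<open>(Suc i, 0)\<close> to earlier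
  vertices ends at \<open>(i, 0)\<close> or, by wrapping, at \<open>(0, 0)\<close>, and both bundles
  are carried already.\<close>

lemma reach_next_row:
  assumes "i < n" "Suc j = n"
  shows "reach step_cost (stage i j) (stage (Suc i) 0)"
proof -
  let ?U = "prefix i j"
  have "reach (3 ^ 4 * 2 ^ 12) (stage i j) (family (insert (i, j) ?U) (carry (Suc i) 0))"
  proof (rule add_vertex)
    show "carry (Suc i) 0 \<inter> cut ?U \<subseteq> carry i j"
    proof
      fix e assume e: "e \<in> carry (Suc i) 0 \<inter> cut ?U"
      have "e \<in> inc (i, 0) \<union> inc (0, 0)"
      proof (rule ccontr)
        assume no: "e \<notin> inc (i, 0) \<union> inc (0, 0)"
        with e have "e \<in> inc (Suc i, 0)" by (auto simp: carry_def)
        then show False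
        proof (cases rule: inc_cases)
          case 1
          then have "succ (Suc i) \<le> i" using e by (auto simp: cut_def prefix_def)
          then have "succ (Suc i) = 0" by (auto simp: succ_def split: if_splits)
          then have "e \<in> inc (0, 0)" using 1 e by (auto simp: cut_def incident_def)
          then show ?thesis using no by blast
        next
          case 2
          then have "e \<in> inc (i, 0)" using e by (auto simp: cut_def incident_def pred_def)
          then show ?thesis using no by blast
        qed (use e in \<open>auto simp: cut_def prefix_def\<close>)
      qed
      then show "e \<in> carry i j" using e by (auto simp: carry_def)
    qed
  qed (use assms card_carry finite_carry in auto)
  moreover have "insert (i, j) ?U = prefix (Suc i) 0"
    using assms by (auto simp: prefix_def)
  ultimately show ?thesis by (elim reach_mono) (auto simp: step_cost_def)
qed

lemma reach_row:
  assumes "i < n" "j < n"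
  shows "reach (j * step_cost) (stage i 0) (stage i j)"
  using assms(2)
proof (induction j)
  case 0
  show ?case by (simp add: reach_refl)
next
  case (Suc j)
  then have "reach (j * step_cost + step_cost) (stage i 0) (stage i (Suc j))"
    using assms(1) by (intro reach_trans[OF _ reach_next]) auto
  then show ?case by (simp only: mult_Suc add.commute)
qed

lemma reach_rows: "i \<le> n \<Longrightarrow> reach (i * (n * step_cost)) {} (stage i 0)"
proof (induction i)
  case 0
  \<comment> \<open>The empty sum of equations reads 0 = 0 and is never violated, so the sweep
    starts without premises.\<close>
  have "stage 0 0 = {}" by (auto simp: family_def prefix_def violates_def)
  then show ?case by (simp add: reach_refl)
next
  case (Suc i)
  obtain j where j: "n = Suc j" using n_ge_3 by (cases n) auto
  have "reach (i * (n * step_cost) + (j * step_cost + step_cost)) {} (stage (Suc i) 0)"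
    using Suc j by (intro reach_trans[OF Suc.IH] reach_trans[OF reach_row reach_next_row]) auto
  moreover have "i * (n * step_cost) + (j * step_cost + step_cost) = Suc i * (n * step_cost)"
    by (simp only: j mult_Suc add_ac)
  ultimately show ?case by (simp only:)
qed

text \<open>No edge leaves the full vertex set, and the number of vertices is odd. The sum of all
  equations is therefore 0 = 1, whose only clause is the empty one.\<close>

lemma torus_size_le:
  assumes "odd n"
  shows "src2_size 3 (torus_tseitin n) \<le> enat (step_cost * n\<^sup>2)"
proof -
  let ?V = "torus_vertices n"
  have V: "prefix n 0 = ?V" by (auto simp: prefix_def torus_vertices_def)
  have "e \<subseteq> ?V" if "e \<in> torus_edges n" for e
    using that succ_less unfolding torus_edges_eq torus_vertices_def by auto
  then have cut: "cut ?V = {}" by (auto simp: cut_def)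
  have "violates ?V {}"
    using assms by (simp add: violates_def torus_vertices_def)
  then have "(clause_of (cut ?V) {}, ?V) \<in> stage n 0"
    unfolding V by (intro in_familyI) auto
  then have "reach (n * (n * step_cost)) {} {({}, ?V)}"
    using reach_mono[OF reach_rows[of n]] cut by auto
  then have "src2_size 3 F \<le> enat (n * (n * step_cost))" by (rule src2_size_le)
  then show ?thesis
    by (simp add: torus_tseitin_def power2_eq_square mult_ac)
qed

end

section \<open>The quadratic bound along odd \<open>n\<close>\<close>

theorem theorem23:
  shows "(\<forall>n. odd n \<and> n \<ge> 3 \<longrightarrow> src2_size 3 (torus_tseitin n) \<noteq> \<infinity>) \<and>
    (\<lambda>n. real (the_enat (src2_size 3 (torus_tseitin n))))
      \<in> O[inf at_top (principal {n. odd n})](\<lambda>n. real n ^ 2)"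
proof -
  \<comment> \<open>The cost per vertex does not depend on \<open>n\<close>, so a single constant
    serves all tori.\<close>
  obtain c where le: "src2_size 3 (torus_tseitin n) \<le> enat (c * n\<^sup>2)" if "odd n" "n \<ge> 3" for n
    using torus.torus_size_le by (metis torus.intro)
  have real_le: "real (the_enat (src2_size 3 (torus_tseitin n))) \<le> real c * real n ^ 2"
    if n: "odd n" "n \<ge> 3" for n
  proof -
    \<comment> \<open>The bound excludes infinity, so \<open>the_enat\<close> returns the actual
      size and not an unspecified value.\<close>
    obtain m where m: "src2_size 3 (torus_tseitin n) = enat m" "m \<le> c * n\<^sup>2"
      using le[OF n] by (cases "src2_size 3 (torus_tseitin n)") auto
    then have "real m \<le> real (c * n\<^sup>2)" by (simp only: of_nat_le_iff)
    then show ?thesis using m(1) by simp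
  qed
  show ?thesis
  proof
    show "\<forall>n. odd n \<and> n \<ge> 3 \<longrightarrow> src2_size 3 (torus_tseitin n) \<noteq> \<infinity>"
      using le by (metis enat_ord_simps(5) enat.distinct(2))
    have "eventually (\<lambda>n. norm (real (the_enat (src2_size 3 (torus_tseitin n))))
        \<le> real c * norm (real n ^ 2)) (inf at_top (principal {n. odd n}))"
      unfolding eventually_inf_principal
      using eventually_ge_at_top[of 3] by eventually_elim (use real_le in auto)
    then show "(\<lambda>n. real (the_enat (src2_size 3 (torus_tseitin n))))
      \<in> O[inf at_top (principal {n. odd n})](\<lambda>n. real n ^ 2)"
      by (rule bigoI)
  qed
qed

end
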